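(* Let $\Theta\subset\mathbb{R}$ and let $\mathcal{P}=\{P_\theta\}_{\theta\in\Theta}$ be a one-dimensional parametric family that is $L^1$-differentiable at $\theta_0$ with score $\dot\ell_{\theta_0}$, where $J_{\theta_0}=\mathbb{E}_{\theta_0}[|\dot\ell_{\theta_0}|]>0$. Let $\psi:\Theta\to\mathbb{R}$ be $\mathcal{C}^1$ near $\theta_0$, and let $\mathcal{Q}_\varepsilon$ be the family of $(2,\varepsilon^2)$-Rényi locally private sequentially interactive channels. Then there is $N=N(\psi,\theta_0,\mathcal{P},\varepsilon)$, depending only on $\psi$, $\theta_0$, the family $\mathcal{P}$ and the privacy level $\varepsilon$, such that for every symmetric quasiconvex loss $L:\mathbb{R}\to\mathbb{R}_+$ with $L(0)=0$ and all $n\ge N$, $$\mathfrak{M}^{\mathrm{loc}}_n(P_{\theta_0},L,\mathcal{P},\mathcal{Q}_\varepsilon)\ \ge\ \frac18\cdot L\!\left(\frac{1}{5\sqrt{2n\varepsilon^2}}\cdot J_{\theta_0}^{-1}\psi'(\theta_0)\right).$$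
   Context: $L^1$-differentiability at $\theta_0$ (an interior point of $\Theta$): with densities $p_\theta=dP_\theta/d\mu$ with respect to a dominating measure $\mu$, $\int|p_{\theta_0+h}-p_{\theta_0}-h\dot\ell_{\theta_0}p_{\theta_0}|\,d\mu=o(|h|)$ as $h\to0$, for some $\dot\ell_{\theta_0}:\mathcal{X}\to\mathbb{R}$. $J_{\theta_0}=\int|\dot\ell_{\theta_0}|dP_{\theta_0}$ is the $L^1$-information. A sequentially interactive channel $Q$ produces $Z_1,\dots,Z_n$ via Markov kernels $Z_i\mid X_i=x,Z_{1:i-1}=z_{1:i-1}\sim Q(\cdot\mid x,z_{1:i-1})$; it is $(2,\varepsilon^2)$-Rényi locally private if $D_2(Q(\cdot\mid x,z_{1:i-1})\|Q(\cdot\mid x',z_{1:i-1}))\le\varepsilon^2$ for all $i,x,x',z_{1:i-1}$, where $D_2(P\|Q)=\log\int(dP/dQ)^2dQ$. The local minimax risk for estimating $\psi(\theta)$ is $$\mathfrak{M}^{\mathrm{loc}}_n(P_{\theta_0},L,\mathcal{P},\mathcal{Q})=\sup_{\theta_1\in\Theta}\ \inf_{\hat\psi,\,Q\in\mathcal{Q}}\ \max_{\theta\in\{\theta_0,\theta_1\}}\mathbb{E}_{Q\circ P_\theta}\big[L(\hat\psi(Z_1,\dots,Z_n)-\psi(\theta))\big],$$ where $Q\circ P$ is the law of $Z_{1:n}$ when $X_i\overset{iid}\sim P$, and the infimum is over all estimators $\hat\psi$ of $Z_{1:n}$.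
   Formalization: Adds ε ≤ 2: for large ε the claim fails (ε = 4, squared loss, Bernoulli(θ) at θ0 = exp(-ε²), each observation flipped with probability exp(-ε²)). N is stated for channels with outputs in one arbitrary fixed type; real outputs already cover all output spaces. *)

theory Defs
  imports "HOL-Probability.Probability"
begin

definition dominated_family :: "'x measure \<Rightarrow> real set \<Rightarrow> (real \<Rightarrow> 'x measure) \<Rightarrow> bool" where
  "dominated_family \<mu> \<Theta> P \<longleftrightarrow> sigma_finite_measure \<mu> \<and>
     (\<forall>\<theta>\<in>\<Theta>. prob_space (P \<theta>) \<and> sets (P \<theta>) = sets \<mu> \<and> absolutely_continuous \<mu> (P \<theta>))"

definition pdens :: "'x measure \<Rightarrow> (real \<Rightarrow> 'x measure) \<Rightarrow> real \<Rightarrow> 'x \<Rightarrow> real" where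
  "pdens \<mu> P \<theta> x = enn2real (RN_deriv \<mu> (P \<theta>) x)"

(* The remainder is required to be integrable for all small h, because the Bochner integral of a
   non-integrable function is 0 and the o(h) condition alone could then hold spuriously. *)
definition L1_differentiable ::
  "'x measure \<Rightarrow> real set \<Rightarrow> (real \<Rightarrow> 'x measure) \<Rightarrow> real \<Rightarrow> ('x \<Rightarrow> real) \<Rightarrow> bool" where
  "L1_differentiable \<mu> \<Theta> P \<theta>0 score \<longleftrightarrow>
     \<theta>0 \<in> interior \<Theta> \<and> score \<in> borel_measurable \<mu> \<and>
     (\<forall>\<^sub>F h in at 0. integrable \<mu>
        (\<lambda>x. pdens \<mu> P (\<theta>0 + h) x - pdens \<mu> P \<theta>0 x - h * score x * pdens \<mu> P \<theta>0 x)) \<and>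
     (\<lambda>h. \<integral>x. \<bar>pdens \<mu> P (\<theta>0 + h) x - pdens \<mu> P \<theta>0 x - h * score x * pdens \<mu> P \<theta>0 x\<bar> \<partial>\<mu>)
       \<in> o[at 0](\<lambda>h. h)"

definition L1_information :: "(real \<Rightarrow> 'x measure) \<Rightarrow> real \<Rightarrow> ('x \<Rightarrow> real) \<Rightarrow> real" where
  "L1_information P \<theta>0 score = (\<integral>x. \<bar>score x\<bar> \<partial>(P \<theta>0))"

(* D_2(P || Q).  RN_deriv Q P is dP/dQ, and absolutely_continuous Q P says P << Q; the value is
   infinite when P << Q fails or the integral diverges. *)
definition renyi_div2 :: "'z measure \<Rightarrow> 'z measure \<Rightarrow> ereal" where
  "renyi_div2 P Q =
     (if absolutely_continuous Q P \<and> (\<integral>\<^sup>+z. (RN_deriv Q P z)\<^sup>2 \<partial>Q) < \<infinity>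
      then ereal (ln (enn2real (\<integral>\<^sup>+z. (RN_deriv Q P z)\<^sup>2 \<partial>Q)))
      else \<infinity>)"

(* A channel carries its own output spaces (a measurable space for every step, with a carrier
   in the type 'z), so an infimum over channels also ranges over the output spaces.  Indices start
   at 0: kern Q i x z is the law of the (i+1)-st output given that the (i+1)-st observation is x
   and that the first i outputs are z. *)
record ('x, 'z) channel =
  outsp :: "nat \<Rightarrow> 'z measure"
  kern :: "nat \<Rightarrow> 'x \<Rightarrow> (nat \<Rightarrow> 'z) \<Rightarrow> 'z measure"

definition history :: "('x, 'z) channel \<Rightarrow> nat \<Rightarrow> (nat \<Rightarrow> 'z) measure" where
  "history Q i = PiM {0..<i} (outsp Q)"

definition seq_interactive :: "'x measure \<Rightarrow> nat \<Rightarrow> ('x, 'z) channel \<Rightarrow> bool" where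
  "seq_interactive X n Q \<longleftrightarrow>
     (\<forall>i<n. (\<lambda>(x, z). kern Q i x z) \<in> X \<Otimes>\<^sub>M history Q i \<rightarrow>\<^sub>M prob_algebra (outsp Q i))"

definition renyi2_private :: "'x measure \<Rightarrow> nat \<Rightarrow> real \<Rightarrow> ('x, 'z) channel \<Rightarrow> bool" where
  "renyi2_private X n \<rho> Q \<longleftrightarrow>
     (\<forall>i<n. \<forall>x\<in>space X. \<forall>x'\<in>space X. \<forall>z\<in>space (history Q i).
        renyi_div2 (kern Q i x z) (kern Q i x' z) \<le> ereal \<rho>)"

definition renyi2_channels :: "'x measure \<Rightarrow> nat \<Rightarrow> real \<Rightarrow> ('x, 'z) channel set" where
  "renyi2_channels X n \<rho> = {Q. seq_interactive X n Q \<and> renyi2_private X n \<rho> Q}"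

(* The law of the first n outputs when the observations are i.i.d. from P: in every step a fresh
   observation x is drawn from P, independently of the past, and then the output w is drawn from
   the kernel given x and the past outputs z. *)
primrec output_law :: "('x, 'z) channel \<Rightarrow> 'x measure \<Rightarrow> nat \<Rightarrow> (nat \<Rightarrow> 'z) measure" where
  "output_law Q P 0 = return (history Q 0) (\<lambda>_. undefined)"
| "output_law Q P (Suc i) =
     output_law Q P i \<bind> (\<lambda>z. P \<bind> (\<lambda>x. distr (kern Q i x z) (history Q (Suc i)) (\<lambda>w. z(i := w))))"

definition risk ::
  "nat \<Rightarrow> (real \<Rightarrow> real) \<Rightarrow> (real \<Rightarrow> 'x measure) \<Rightarrow> (real \<Rightarrow> real) \<Rightarrow>
   ('x, 'z) channel \<Rightarrow> ((nat \<Rightarrow> 'z) \<Rightarrow> real) \<Rightarrow> real \<Rightarrow> ennreal" where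
  "risk n L P \<psi> Q est \<theta> = (\<integral>\<^sup>+z. ennreal (L (est z - \<psi> \<theta>)) \<partial>(output_law Q (P \<theta>) n))"

definition local_minimax_risk ::
  "nat \<Rightarrow> real \<Rightarrow> (real \<Rightarrow> real) \<Rightarrow> real set \<Rightarrow> (real \<Rightarrow> 'x measure) \<Rightarrow> (real \<Rightarrow> real) \<Rightarrow>
   ('x, 'z) channel set \<Rightarrow> ennreal" where
  "local_minimax_risk n \<theta>0 L \<Theta> P \<psi> \<Q> =
     (SUP \<theta>1\<in>\<Theta>. INF Q\<in>\<Q>. INF est\<in>history Q n \<rightarrow>\<^sub>M borel.
        max (risk n L P \<psi> Q est \<theta>0) (risk n L P \<psi> Q est \<theta>1))"

definition quasiconvex :: "(real \<Rightarrow> real) \<Rightarrow> bool" where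
  "quasiconvex L \<longleftrightarrow>
     (\<forall>x y t. 0 \<le> t \<and> t \<le> 1 \<longrightarrow> L (t * x + (1 - t) * y) \<le> max (L x) (L y))"

end

theory Submission
  imports Defs
begin

text \<open>
  The proof is Le Cam's method with the two points \<open>\<theta>0\<close> and \<open>\<theta>0 + h\<close>, where
  \<open>h = 0.29 / (\<epsilon> J sqrt n)\<close> and \<open>J\<close> is the \<open>L\<^sup>1\<close>-information. The values
  of \<open>\<psi>\<close> at these points are about \<open>h |\<psi>'(\<theta>0)|\<close> apart, which is at least twice the
  size of the argument of the loss in the claim (\<open>separation_bound\<close>). It remains to show that no
  private channel produces output laws whose probabilities differ by more than 3/4; then Le Cam's
  inequality gives the factor \<open>(1 - 3/4) / 2 = 1/8\<close> (\<open>le_cam_two_point\<close>).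

  The output laws are compared in chi-square divergence. One step sends the data law
  \<open>P \<theta>\<close> to a mixture of the channel's kernels, and the difference of the two mixtures only sees
  how far the kernels are from their average. Privacy bounds that by
  \<open>exp (\<epsilon>\<^sup>2) - 1\<close> in chi-square divergence. Hence the divergence of the two mixtures is at
  most \<open>(exp (\<epsilon>\<^sup>2) - 1) D\<^sup>2\<close>, where \<open>D\<close> is the \<open>L\<^sup>1\<close> distance of the two
  densities (\<open>chi2_bounded_channel\<close>). This is where the \<open>L\<^sup>1\<close>-information comes from:
  differentiability gives \<open>D \<le> (1 + o(1)) J h\<close> (\<open>L1_distance_le_information\<close>).

  The quantity \<open>1 + \<chi>\<^sup>2\<close> multiplies along the steps of the channel, even though each kernel may
  depend on the past outputs (\<open>chi2_bounded_bind\<close>, \<open>output_law_chi2_bounded\<close>). After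
  \<open>n\<close> steps it is at most \<open>exp (n (exp (\<epsilon>\<^sup>2) - 1) D\<^sup>2)\<close>. For \<open>\<epsilon> \<le> 2\<close> the
  factor \<open>exp (\<epsilon>\<^sup>2) - 1\<close> is below \<open>13.5 \<epsilon>\<^sup>2\<close>, and this cancels against
  \<open>D\<^sup>2\<close> and leaves a bound below 13/4 (\<open>privacy_budget_bound\<close>). A set of probabilities
  \<open>p\<close> and \<open>q\<close> satisfies \<open>(p - q)\<^sup>2 \<le> \<chi>\<^sup>2 q (1 - q)\<close>, so the difference of the
  probabilities is at most \<open>sqrt (9/4) / 2 = 3/4\<close> (\<open>chi2_bounded_prob_diff\<close>).

  The threshold for \<open>n\<close> depends only on how small \<open>h\<close> has to be for the two linearizations,
  with errors of 1 and 2 percent, and so neither on the loss nor on the channel.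
\<close>

section \<open>Bounded functions under probability kernels\<close>

lemma bounded_integrable:
  fixes f :: "'a \<Rightarrow> real"
  assumes "M \<in> space (prob_algebra S)" "f \<in> borel_measurable S" "\<And>x. x \<in> space S \<Longrightarrow> \<bar>f x\<bar> \<le> B"
  shows "integrable M f"
proof -
  have sets: "sets M = sets S" and "prob_space M" using assms(1) by (auto simp: space_prob_algebra)
  interpret prob_space M by fact
  show ?thesis
    using assms(2,3) sets sets_eq_imp_space_eq[OF sets]
    by (intro integrable_const_bound[where B=B]) (auto cong: measurable_cong_sets)
qed

lemma abs_integral_le_bound:
  fixes f :: "'a \<Rightarrow> real"
  assumes M: "M \<in> space (prob_algebra S)" and f: "f \<in> borel_measurable S"
    and b: "\<And>x. x \<in> space S \<Longrightarrow> \<bar>f x\<bar> \<le> B"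
  shows "\<bar>\<integral>x. f x \<partial>M\<bar> \<le> B"
proof -
  have sets: "sets M = sets S" and "prob_space M" using M by (auto simp: space_prob_algebra)
  interpret prob_space M by fact
  have i: "integrable M f" by (rule bounded_integrable[OF M f b])
  have "\<bar>\<integral>x. f x \<partial>M\<bar> \<le> (\<integral>x. \<bar>f x\<bar> \<partial>M)" by (rule integral_abs_bound)
  also have "\<dots> \<le> B"
    using b sets_eq_imp_space_eq[OF sets]
    by (intro integral_le_const integrable_abs[OF i] AE_I2) auto
  finally show ?thesis .
qed

lemma square_bound: "\<bar>y::real\<bar> \<le> B \<Longrightarrow> \<bar>y\<^sup>2\<bar> \<le> B\<^sup>2"
  by (metis abs_ge_zero abs_power2 power2_abs power_mono)

lemma kernel_integral_measurable:
  fixes f :: "'b \<Rightarrow> real"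
  assumes "\<kappa> \<in> X \<rightarrow>\<^sub>M prob_algebra S" "f \<in> borel_measurable S"
  shows "(\<lambda>x. \<integral>y. f y \<partial>\<kappa> x) \<in> borel_measurable X"
  by (rule measurable_compose[OF measurable_prob_algebraD[OF assms(1)]
        integral_measurable_subprob_algebra[OF assms(2)]])

lemma kernel_integral_bound:
  fixes f :: "'b \<Rightarrow> real"
  assumes "\<kappa> \<in> X \<rightarrow>\<^sub>M prob_algebra S" "f \<in> borel_measurable S"
    "\<And>y. y \<in> space S \<Longrightarrow> \<bar>f y\<bar> \<le> B" "x \<in> space X"
  shows "\<bar>\<integral>y. f y \<partial>\<kappa> x\<bar> \<le> B"
  by (rule abs_integral_le_bound[OF measurable_space[OF assms(1,4)] assms(2,3)])

lemma integral_bind_kernel: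
  fixes f :: "'b \<Rightarrow> real"
  assumes M: "M \<in> space (prob_algebra X)" and \<kappa>: "\<kappa> \<in> X \<rightarrow>\<^sub>M prob_algebra S"
    and f: "f \<in> borel_measurable S" and b: "\<And>y. y \<in> space S \<Longrightarrow> \<bar>f y\<bar> \<le> B"
  shows "(\<integral>y. f y \<partial>(M \<bind> \<kappa>)) = (\<integral>x. (\<integral>y. f y \<partial>\<kappa> x) \<partial>M)"
proof (rule integral_bind[OF f b, where B'=1])
  have sets: "sets M = sets X" and "prob_space M" using M by (auto simp: space_prob_algebra)
  interpret prob_space M by fact
  show "finite_measure M" by (rule finite_measure_axioms)
  show "\<kappa> \<in> M \<rightarrow>\<^sub>M subprob_algebra S"
    using measurable_prob_algebraD[OF \<kappa>] sets by (simp cong: measurable_cong_sets)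
  show "AE x in M. emeasure (\<kappa> x) (space (\<kappa> x)) \<le> ennreal 1"
    using measurable_space[OF \<kappa>] sets_eq_imp_space_eq[OF sets]
    by (intro AE_I2) (auto simp: space_prob_algebra prob_space.emeasure_space_1)
qed

lemma bind_prob_algebra:
  assumes "M \<in> space (prob_algebra X)" "\<kappa> \<in> X \<rightarrow>\<^sub>M prob_algebra S"
  shows "M \<bind> \<kappa> \<in> space (prob_algebra S)"
  using sets_bind'[OF assms] prob_space_bind'[OF assms] by (simp add: space_prob_algebra)

section \<open>Chi-square bounds in dual form\<close>

text \<open>
  If \<open>M\<close> has a density \<open>r\<close> with respect to \<open>N\<close>, the least such \<open>K\<close> is the second moment
  \<open>\<integral> r\<^sup>2 dN = 1 + \<chi>\<^sup>2(M \<parallel> N)\<close>, by the self-duality of \<open>L\<^sup>2(N)\<close>. The dual form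
  mentions no density, so it can be pushed through mixtures and sequential compositions without
  choosing jointly measurable densities. Bounded test functions suffice, and they keep all integrals
  finite.
\<close>

definition chi2_bounded :: "real \<Rightarrow> 'a measure \<Rightarrow> 'a measure \<Rightarrow> bool" where
  "chi2_bounded K M N \<longleftrightarrow>
     (\<forall>f B. f \<in> borel_measurable N \<longrightarrow> (\<forall>x\<in>space N. \<bar>f x\<bar> \<le> B) \<longrightarrow>
        (\<integral>x. f x \<partial>M)\<^sup>2 \<le> K * (\<integral>x. (f x)\<^sup>2 \<partial>N))"

lemma chi2_boundedI:
  assumes "sets N = sets S"
    and "\<And>f B. f \<in> borel_measurable S \<Longrightarrow> (\<And>x. x \<in> space S \<Longrightarrow> \<bar>f x\<bar> \<le> B) \<Longrightarrow>
      (\<integral>x. f x \<partial>M)\<^sup>2 \<le> K * (\<integral>x. (f x)\<^sup>2 \<partial>N)"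
  shows "chi2_bounded K M N"
  unfolding chi2_bounded_def
proof (intro allI impI)
  fix f :: "'a \<Rightarrow> real" and B
  assume "f \<in> borel_measurable N" "\<forall>x\<in>space N. \<bar>f x\<bar> \<le> B"
  then show "(\<integral>x. f x \<partial>M)\<^sup>2 \<le> K * (\<integral>x. (f x)\<^sup>2 \<partial>N)"
    using sets_eq_imp_space_eq[OF assms(1)] measurable_cong_sets[OF assms(1) refl]
    by (intro assms(2)) auto
qed

lemma chi2_boundedD:
  assumes "chi2_bounded K M N" "sets N = sets S" "f \<in> borel_measurable S"
    "\<And>x. x \<in> space S \<Longrightarrow> \<bar>f x\<bar> \<le> B"
  shows "(\<integral>x. f x \<partial>M)\<^sup>2 \<le> K * (\<integral>x. (f x)\<^sup>2 \<partial>N)"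
proof -
  have "f \<in> borel_measurable N" using assms(3) by (simp add: measurable_cong_sets[OF assms(2) refl])
  moreover have "\<forall>x\<in>space N. \<bar>f x\<bar> \<le> B" using assms(4) sets_eq_imp_space_eq[OF assms(2)] by simp
  ultimately show ?thesis using assms(1) unfolding chi2_bounded_def by blast
qed

lemma chi2_bounded_mono:
  assumes "chi2_bounded K M N" "K \<le> K'"
  shows "chi2_bounded K' M N"
proof -
  have "K * (\<integral>x. (f x)\<^sup>2 \<partial>N) \<le> K' * (\<integral>x. (f x)\<^sup>2 \<partial>N)" for f :: "'a \<Rightarrow> real"
    by (intro mult_right_mono assms(2)) simp
  then show ?thesis using assms(1) unfolding chi2_bounded_def by (meson order_trans)
qed

lemma ennreal_square: "0 \<le> r \<Longrightarrow> (ennreal r)\<^sup>2 = ennreal (r\<^sup>2)"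
  by (simp add: ennreal_power)

text \<open>
  Writing \<open>\<integral>|f| dM = \<integral>|f| r dN\<close> with \<open>r = dM/dN\<close>, this is the Cauchy--Schwarz inequality,
  since the Renyi divergence of order 2 is the logarithm of \<open>\<integral>r\<^sup>2 dN\<close>.
\<close>

lemma renyi_div2_chi2_bounded:
  assumes M: "M \<in> space (prob_algebra S)" and N: "N \<in> space (prob_algebra S)"
    and r: "renyi_div2 M N \<le> ereal \<rho>"
  shows "chi2_bounded (exp \<rho>) M N"
proof (rule chi2_boundedI)
  show sN: "sets N = sets S" using N by (simp add: space_prob_algebra)
  have sM: "sets M = sets S" using M by (simp add: space_prob_algebra)
  interpret N: prob_space N using N by (simp add: space_prob_algebra)
  define I where "I = (\<integral>\<^sup>+z. (RN_deriv N M z)\<^sup>2 \<partial>N)"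
  have ac: "absolutely_continuous N M" and fin: "I < \<infinity>" and ln: "ln (enn2real I) \<le> \<rho>"
    using r unfolding renyi_div2_def I_def by (auto split: if_splits)
  have IE: "I \<le> ennreal (exp \<rho>)"
  proof -
    have "enn2real I \<le> exp \<rho>"
    proof (cases "enn2real I > 0")
      case True then show ?thesis using ln by (metis exp_le_cancel_iff exp_ln)
    next
      case False
      then have "enn2real I \<le> 0" by simp
      then show ?thesis using exp_gt_zero[of \<rho>] by linarith
    qed
    then show ?thesis using fin by (simp add: enn2real_le)
  qed
  fix f :: "_ \<Rightarrow> real" and B
  assume f[measurable]: "f \<in> borel_measurable S" and b: "\<And>x. x \<in> space S \<Longrightarrow> \<bar>f x\<bar> \<le> B"
  have [measurable]: "f \<in> borel_measurable N" using f sN by (simp cong: measurable_cong_sets)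
  have [measurable]: "f \<in> borel_measurable M" using f sM by (simp cong: measurable_cong_sets)
  have iM: "integrable M (\<lambda>x. \<bar>f x\<bar>)"
    using bounded_integrable[OF M f b] by auto
  have iN: "integrable N (\<lambda>x. (f x)\<^sup>2)"
    by (rule bounded_integrable[OF N]) (use f b square_bound in auto)
  have "ennreal ((\<integral>x. \<bar>f x\<bar> \<partial>M)\<^sup>2) = (\<integral>\<^sup>+x. ennreal \<bar>f x\<bar> \<partial>M)\<^sup>2"
    using iM by (simp add: nn_integral_eq_integral ennreal_power)
  also have "(\<integral>\<^sup>+x. ennreal \<bar>f x\<bar> \<partial>M) = (\<integral>\<^sup>+x. RN_deriv N M x * ennreal \<bar>f x\<bar> \<partial>N)"
    by (rule N.RN_deriv_nn_integral) (use ac sM sN in auto)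
  also have "\<dots>\<^sup>2 \<le> I * (\<integral>\<^sup>+x. (ennreal \<bar>f x\<bar>)\<^sup>2 \<partial>N)"
    unfolding I_def by (rule Cauchy_Schwarz_nn_integral) auto
  also have "\<dots> \<le> ennreal (exp \<rho>) * (\<integral>\<^sup>+x. (ennreal \<bar>f x\<bar>)\<^sup>2 \<partial>N)"
    by (intro mult_right_mono IE) auto
  also have "(\<integral>\<^sup>+x. (ennreal \<bar>f x\<bar>)\<^sup>2 \<partial>N) = ennreal (\<integral>x. (f x)\<^sup>2 \<partial>N)"
    using iN by (simp add: ennreal_square nn_integral_eq_integral)
  also have "ennreal (exp \<rho>) * \<dots> = ennreal (exp \<rho> * (\<integral>x. (f x)\<^sup>2 \<partial>N))"
    by (simp add: ennreal_mult)
  finally have "(\<integral>x. \<bar>f x\<bar> \<partial>M)\<^sup>2 \<le> exp \<rho> * (\<integral>x. (f x)\<^sup>2 \<partial>N)"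
    by (subst (asm) ennreal_le_iff) auto
  moreover have "(\<integral>x. f x \<partial>M)\<^sup>2 \<le> (\<integral>x. \<bar>f x\<bar> \<partial>M)\<^sup>2"
    by (subst power2_abs[symmetric], rule power_mono) auto
  ultimately show "(\<integral>x. f x \<partial>M)\<^sup>2 \<le> exp \<rho> * (\<integral>x. (f x)\<^sup>2 \<partial>N)" by simp
qed

text \<open>
  The right-hand side of the defining inequality is linear in the second measure, so averaging the
  inequality over \<open>P\<close> suffices.
\<close>

lemma chi2_bounded_bind_right:
  assumes P: "P \<in> space (prob_algebra X)" and \<kappa>: "\<kappa> \<in> X \<rightarrow>\<^sub>M prob_algebra S"
    and K: "\<And>x. x \<in> space X \<Longrightarrow> chi2_bounded K M (\<kappa> x)"
  shows "chi2_bounded K M (P \<bind> \<kappa>)"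
proof (rule chi2_boundedI)
  show "sets (P \<bind> \<kappa>) = sets S" by (rule sets_bind'[OF P \<kappa>])
  have sP: "space P = space X" using P by (auto simp: space_prob_algebra dest: sets_eq_imp_space_eq)
  interpret P: prob_space P using P by (simp add: space_prob_algebra)
  fix f :: "_ \<Rightarrow> real" and B
  assume f[measurable]: "f \<in> borel_measurable S" and b: "\<And>x. x \<in> space S \<Longrightarrow> \<bar>f x\<bar> \<le> B"
  note f2 = \<kappa> borel_measurable_power[OF f] square_bound[OF b]
  have "(\<integral>y. f y \<partial>M)\<^sup>2 \<le> (\<integral>x. K * (\<integral>y. (f y)\<^sup>2 \<partial>\<kappa> x) \<partial>P)"
  proof (rule P.integral_ge_const)
    show "integrable P (\<lambda>x. K * (\<integral>y. (f y)\<^sup>2 \<partial>\<kappa> x))"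
      using bounded_integrable[OF P kernel_integral_measurable[OF f2(1,2)] kernel_integral_bound[OF f2]]
      by simp
    show "AE x in P. (\<integral>y. f y \<partial>M)\<^sup>2 \<le> K * (\<integral>y. (f y)\<^sup>2 \<partial>\<kappa> x)"
    proof (rule AE_I2)
      fix x assume "x \<in> space P"
      then have x: "x \<in> space X" using sP by simp
      have "sets (\<kappa> x) = sets S" using measurable_space[OF \<kappa> x] by (simp add: space_prob_algebra)
      then show "(\<integral>y. f y \<partial>M)\<^sup>2 \<le> K * (\<integral>y. (f y)\<^sup>2 \<partial>\<kappa> x)"
        by (rule chi2_boundedD[OF K[OF x] _ f b])
    qed
  qed
  also have "\<dots> = K * (\<integral>y. (f y)\<^sup>2 \<partial>(P \<bind> \<kappa>))"
    by (simp add: integral_bind_kernel[OF P f2])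
  finally show "(\<integral>y. f y \<partial>M)\<^sup>2 \<le> K * (\<integral>y. (f y)\<^sup>2 \<partial>(P \<bind> \<kappa>))" .
qed

text \<open>
  The Hammersley--Chapman--Robbins inequality. The defining inequality can be applied to every
  translate \<open>f - c\<close>. With \<open>d\<close> the difference of the two means, \<open>v\<close> the variance of \<open>f\<close> under
  \<open>N\<close>, and \<open>u\<close> the mean of \<open>f - c\<close> under \<open>N\<close>, it says
  \<open>(d + u)\<^sup>2 \<le> K (v + u\<^sup>2)\<close>. This quadratic inequality in \<open>u\<close> is sharpest at \<open>u = d / (K - 1)\<close>.
\<close>

lemma chi2_bounded_centred:
  fixes f :: "'a \<Rightarrow> real"
  assumes M: "M \<in> space (prob_algebra S)" and N: "N \<in> space (prob_algebra S)"
    and K: "chi2_bounded K M N" and f: "f \<in> borel_measurable S"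
    and b: "\<And>x. x \<in> space S \<Longrightarrow> \<bar>f x\<bar> \<le> B" and K1: "1 < K"
  shows "((\<integral>x. f x \<partial>M) - (\<integral>x. f x \<partial>N))\<^sup>2 \<le> (K - 1) * ((\<integral>x. (f x)\<^sup>2 \<partial>N) - (\<integral>x. f x \<partial>N)\<^sup>2)"
proof -
  interpret N: prob_space N using N by (simp add: space_prob_algebra)
  interpret M: prob_space M using M by (simp add: space_prob_algebra)
  have sN: "sets N = sets S" using N by (simp add: space_prob_algebra)
  define a where "a = (\<integral>x. f x \<partial>N)"
  define d where "d = (\<integral>x. f x \<partial>M) - a"
  define v where "v = (\<integral>x. (f x)\<^sup>2 \<partial>N) - a\<^sup>2"
  have iM: "integrable M f" and iN: "integrable N f"
    by (rule bounded_integrable[OF M f b] bounded_integrable[OF N f b]; assumption)+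
  have iN2: "integrable N (\<lambda>x. (f x)\<^sup>2)"
    by (rule bounded_integrable[OF N]) (use f b square_bound in auto)
  have main: "(d + u)\<^sup>2 \<le> K * (v + u\<^sup>2)" for u
  proof -
    have "(\<integral>x. f x - (a - u) \<partial>M)\<^sup>2 \<le> K * (\<integral>x. (f x - (a - u))\<^sup>2 \<partial>N)"
    proof (rule chi2_boundedD[OF K sN])
      show "\<bar>f x - (a - u)\<bar> \<le> B + \<bar>a - u\<bar>" if "x \<in> space S" for x
        using b[OF that] by linarith
    qed (use f in auto)
    moreover have "(\<integral>x. f x - (a - u) \<partial>M) = d + u"
      using iM by (simp add: d_def M.prob_space)
    moreover have "(\<integral>x. (f x - (a - u))\<^sup>2 \<partial>N) = v + u\<^sup>2"
    proof -
      have "(\<integral>x. (f x - (a - u))\<^sup>2 \<partial>N) = (\<integral>x. (f x)\<^sup>2 - 2 * (a - u) * f x + (a - u)\<^sup>2 \<partial>N)"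
        by (intro Bochner_Integration.integral_cong) (auto simp: power2_eq_square algebra_simps)
      also have "\<dots> = (\<integral>x. (f x)\<^sup>2 \<partial>N) - 2 * (a - u) * a + (a - u)\<^sup>2"
        using iN iN2 by (simp add: a_def N.prob_space)
      also have "\<dots> = v + u\<^sup>2" by (simp add: v_def power2_eq_square algebra_simps)
      finally show ?thesis .
    qed
    ultimately show ?thesis by simp
  qed
  have "(d + d / (K - 1))\<^sup>2 \<le> K * (v + (d / (K - 1))\<^sup>2)" by (rule main)
  moreover have "d + d / (K - 1) = K * (d / (K - 1))" using K1 by (simp add: field_simps)
  ultimately have "K * (K * (d / (K - 1))\<^sup>2) \<le> K * (v + (d / (K - 1))\<^sup>2)"
    by (simp add: power2_eq_square algebra_simps)
  then have "K * (d / (K - 1))\<^sup>2 \<le> v + (d / (K - 1))\<^sup>2"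
    by (rule mult_left_le_imp_le) (use K1 in simp)
  then have "(K - 1) * (d / (K - 1))\<^sup>2 \<le> v" by (simp add: algebra_simps)
  then have "d\<^sup>2 / (K - 1) \<le> v" using K1 by (simp add: power2_eq_square)
  then show ?thesis using K1 by (simp add: d_def v_def a_def field_simps)
qed

text \<open>
  The contraction of a private channel. Let \<open>q(x)\<close> be the mean of \<open>f\<close> under \<open>\<kappa> x\<close>, centred at
  its mean \<open>a\<close> under the output law \<open>P0 \<bind> \<kappa>\<close>. Each \<open>\<kappa> x\<close> is chi-square close to that output
  law, because it is close to every law in the mixture; so \<open>q\<close> is bounded by
  \<open>\<sigma> = sqrt((K - 1) Var f)\<close>. The two output means of \<open>f\<close> differ by the difference of the
  integrals of \<open>q\<close> under \<open>P1\<close> and \<open>P0\<close>, which is at most \<open>D \<sigma>\<close>. Thus \<open>D\<close> enters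
  squared, multiplied by \<open>K - 1\<close>. Without privacy the \<open>L\<^sup>1\<close> distance would not control the
  chi-square divergence of the outputs at all.
\<close>

lemma chi2_bounded_channel:
  assumes P0: "P0 \<in> space (prob_algebra X)" and P1: "P1 \<in> space (prob_algebra X)"
    and \<kappa>: "\<kappa> \<in> X \<rightarrow>\<^sub>M prob_algebra S"
    and K: "\<And>x x'. x \<in> space X \<Longrightarrow> x' \<in> space X \<Longrightarrow> chi2_bounded K (\<kappa> x) (\<kappa> x')" and K1: "1 < K"
    and D: "\<And>g B. g \<in> borel_measurable X \<Longrightarrow> (\<And>x. x \<in> space X \<Longrightarrow> \<bar>g x\<bar> \<le> B) \<Longrightarrow>
       \<bar>(\<integral>x. g x \<partial>P1) - (\<integral>x. g x \<partial>P0)\<bar> \<le> D * B"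
  shows "chi2_bounded (1 + (K - 1) * D\<^sup>2) (P1 \<bind> \<kappa>) (P0 \<bind> \<kappa>)"
proof (rule chi2_boundedI)
  let ?M0 = "P0 \<bind> \<kappa>" and ?M1 = "P1 \<bind> \<kappa>"
  have M0: "?M0 \<in> space (prob_algebra S)" by (rule bind_prob_algebra[OF P0 \<kappa>])
  show "sets (P0 \<bind> \<kappa>) = sets S" by (rule sets_bind'[OF P0 \<kappa>])
  interpret P0: prob_space P0 using P0 by (simp add: space_prob_algebra)
  interpret P1: prob_space P1 using P1 by (simp add: space_prob_algebra)
  fix f :: "_ \<Rightarrow> real" and B
  assume f[measurable]: "f \<in> borel_measurable S" and b: "\<And>x. x \<in> space S \<Longrightarrow> \<bar>f x\<bar> \<le> B"
  define a where "a = (\<integral>y. f y \<partial>?M0)"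
  define s where "s = (\<integral>y. (f y)\<^sup>2 \<partial>?M0)"
  define q where "q x = (\<integral>y. f y \<partial>\<kappa> x) - a" for x
  have cent: "(q x)\<^sup>2 \<le> (K - 1) * (s - a\<^sup>2)" if x: "x \<in> space X" for x
    unfolding q_def a_def s_def
    by (rule chi2_bounded_centred[OF measurable_space[OF \<kappa> x] M0
          chi2_bounded_bind_right[OF P0 \<kappa> K[OF x]] f b K1])
  obtain x0 where "x0 \<in> space X"
    using P0.not_empty P0 by (auto simp: space_prob_algebra dest: sets_eq_imp_space_eq)
  then have "0 \<le> (K - 1) * (s - a\<^sup>2)" using cent by (meson order_trans zero_le_power2)
  then have sa: "0 \<le> s - a\<^sup>2" using K1 by (simp add: zero_le_mult_iff)
  define \<sigma> where "\<sigma> = sqrt ((K - 1) * (s - a\<^sup>2))"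
  have \<sigma>2: "\<sigma>\<^sup>2 = (K - 1) * (s - a\<^sup>2)" using sa K1 by (simp add: \<sigma>_def)
  have qb: "\<bar>q x\<bar> \<le> \<sigma>" if "x \<in> space X" for x
    using cent[OF that] by (simp add: \<sigma>_def real_le_rsqrt)
  have qm: "q \<in> borel_measurable X"
    unfolding q_def using kernel_integral_measurable[OF \<kappa> f] by simp
  have i: "integrable P' (\<lambda>x. \<integral>y. f y \<partial>\<kappa> x)" if "P' \<in> space (prob_algebra X)" for P'
    by (rule bounded_integrable[OF that kernel_integral_measurable[OF \<kappa> f] kernel_integral_bound[OF \<kappa> f b]])
  have e0: "(\<integral>x. q x \<partial>P0) = 0"
    unfolding q_def using i[OF P0] integral_bind_kernel[OF P0 \<kappa> f b]
    by (simp add: a_def P0.prob_space)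
  have e1: "(\<integral>x. q x \<partial>P1) = (\<integral>y. f y \<partial>?M1) - a"
    unfolding q_def using i[OF P1] integral_bind_kernel[OF P1 \<kappa> f b]
    by (simp add: P1.prob_space)
  have "\<bar>(\<integral>y. f y \<partial>?M1) - a\<bar> \<le> D * \<sigma>" using D[OF qm qb] e0 e1 by simp
  then have "\<bar>(\<integral>y. f y \<partial>?M1)\<bar> \<le> \<bar>\<bar>a\<bar> * 1 + sqrt (s - a\<^sup>2) * (sqrt (K - 1) * D)\<bar>"
    by (simp add: \<sigma>_def real_sqrt_mult mult_ac)
  then have "(\<integral>y. f y \<partial>?M1)\<^sup>2 \<le> (\<bar>a\<bar> * 1 + sqrt (s - a\<^sup>2) * (sqrt (K - 1) * D))\<^sup>2"
    by (metis abs_le_square_iff)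
  \<comment> \<open>Cauchy--Schwarz in the plane recombines the squared mean and the variance into the second moment.\<close>
  also have "\<dots> \<le> (\<bar>a\<bar>\<^sup>2 + (sqrt (s - a\<^sup>2))\<^sup>2) * (1\<^sup>2 + (sqrt (K - 1) * D)\<^sup>2)"
  proof -
    have "(p * 1 + r * t)\<^sup>2 \<le> (p\<^sup>2 + r\<^sup>2) * (1\<^sup>2 + t\<^sup>2)" for p r t :: real
      using zero_le_power2[of "p * t - r"] by (simp add: power2_eq_square algebra_simps)
    then show ?thesis .
  qed
  also have "\<dots> = (1 + (K - 1) * D\<^sup>2) * s"
    using sa K1 by (simp add: power_mult_distrib)
  finally show "(\<integral>y. f y \<partial>?M1)\<^sup>2 \<le> (1 + (K - 1) * D\<^sup>2) * (\<integral>y. (f y)\<^sup>2 \<partial>?M0)"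
    by (simp add: s_def)
qed

text \<open>
  Tensorization. The bounds multiply along a sequential composition because a test function on the
  outputs turns, after one step, into the test function \<open>x \<mapsto> \<integral> f d(\<kappa>1 x)\<close> on the inputs.
\<close>

lemma chi2_bounded_bind:
  assumes M0: "M0 \<in> space (prob_algebra X)" and M1: "M1 \<in> space (prob_algebra X)"
    and \<kappa>0: "\<kappa>0 \<in> X \<rightarrow>\<^sub>M prob_algebra S" and \<kappa>1: "\<kappa>1 \<in> X \<rightarrow>\<^sub>M prob_algebra S"
    and K: "chi2_bounded K M1 M0" and K0: "0 \<le> K"
    and K': "\<And>x. x \<in> space X \<Longrightarrow> chi2_bounded K' (\<kappa>1 x) (\<kappa>0 x)"
  shows "chi2_bounded (K * K') (M1 \<bind> \<kappa>1) (M0 \<bind> \<kappa>0)"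
proof (rule chi2_boundedI)
  show "sets (M0 \<bind> \<kappa>0) = sets S" by (rule sets_bind'[OF M0 \<kappa>0])
  have sM0: "sets M0 = sets X" using M0 by (simp add: space_prob_algebra)
  fix f :: "_ \<Rightarrow> real" and B
  assume f[measurable]: "f \<in> borel_measurable S" and b: "\<And>x. x \<in> space S \<Longrightarrow> \<bar>f x\<bar> \<le> B"
  note f2 = borel_measurable_power[OF f] square_bound[OF b]
  define g where "g x = (\<integral>y. f y \<partial>\<kappa>1 x)" for x
  have gm: "g \<in> borel_measurable X" unfolding g_def by (rule kernel_integral_measurable[OF \<kappa>1 f])
  have gb: "\<bar>g x\<bar> \<le> B" if "x \<in> space X" for x
    unfolding g_def by (rule kernel_integral_bound[OF \<kappa>1 f b that])
  have "(\<integral>y. f y \<partial>(M1 \<bind> \<kappa>1))\<^sup>2 = (\<integral>x. g x \<partial>M1)\<^sup>2"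
    by (simp add: integral_bind_kernel[OF M1 \<kappa>1 f b] g_def)
  also have "\<dots> \<le> K * (\<integral>x. (g x)\<^sup>2 \<partial>M0)"
    by (rule chi2_boundedD[OF K sM0 gm gb])
  also have "\<dots> \<le> K * (\<integral>x. K' * (\<integral>y. (f y)\<^sup>2 \<partial>\<kappa>0 x) \<partial>M0)"
  proof (intro mult_left_mono integral_mono K0)
    show "integrable M0 (\<lambda>x. (g x)\<^sup>2)"
      by (rule bounded_integrable[OF M0]) (use gm square_bound[OF gb] in auto)
    show "integrable M0 (\<lambda>x. K' * (\<integral>y. (f y)\<^sup>2 \<partial>\<kappa>0 x))"
      using bounded_integrable[OF M0 kernel_integral_measurable[OF \<kappa>0 f2(1)] kernel_integral_bound[OF \<kappa>0 f2]]
      by simp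
    fix x assume "x \<in> space M0"
    then have x: "x \<in> space X" using sets_eq_imp_space_eq[OF sM0] by simp
    have "sets (\<kappa>0 x) = sets S" using measurable_space[OF \<kappa>0 x] by (simp add: space_prob_algebra)
    then show "(g x)\<^sup>2 \<le> K' * (\<integral>y. (f y)\<^sup>2 \<partial>\<kappa>0 x)"
      unfolding g_def by (rule chi2_boundedD[OF K'[OF x] _ f b])
  qed
  also have "\<dots> = K * K' * (\<integral>y. (f y)\<^sup>2 \<partial>(M0 \<bind> \<kappa>0))"
    by (simp add: integral_bind_kernel[OF M0 \<kappa>0 f2])
  finally show "(\<integral>y. f y \<partial>(M1 \<bind> \<kappa>1))\<^sup>2 \<le> K * K' * (\<integral>y. (f y)\<^sup>2 \<partial>(M0 \<bind> \<kappa>0))" .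
qed

lemma chi2_bounded_distr:
  assumes M: "sets M = sets S" and N: "sets N = sets S" and T: "T \<in> S \<rightarrow>\<^sub>M R" and K: "chi2_bounded K M N"
  shows "chi2_bounded K (distr M R T) (distr N R T)"
proof (rule chi2_boundedI)
  show "sets (distr N R T) = sets R" by simp
  fix f :: "_ \<Rightarrow> real" and B
  assume f[measurable]: "f \<in> borel_measurable R" and b: "\<And>x. x \<in> space R \<Longrightarrow> \<bar>f x\<bar> \<le> B"
  have [measurable]: "T \<in> M \<rightarrow>\<^sub>M R" "T \<in> N \<rightarrow>\<^sub>M R" using T M N by (simp_all cong: measurable_cong_sets)
  have "(\<integral>x. f (T x) \<partial>M)\<^sup>2 \<le> K * (\<integral>x. (f (T x))\<^sup>2 \<partial>N)"
    by (rule chi2_boundedD[OF K N measurable_compose[OF T f] b[OF measurable_space[OF T]]])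
  then show "(\<integral>x. f x \<partial>distr M R T)\<^sup>2 \<le> K * (\<integral>x. (f x)\<^sup>2 \<partial>distr N R T)"
    by (simp add: integral_distr)
qed

text \<open>
  The centred inequality for the indicator of \<open>A\<close>, whose variance is at most 1/4.
\<close>

lemma chi2_bounded_prob_diff:
  assumes M: "M \<in> space (prob_algebra S)" and N: "N \<in> space (prob_algebra S)"
    and K: "chi2_bounded K M N" and K1: "1 < K" and A: "A \<in> sets S"
  shows "measure M A - measure N A \<le> sqrt (K - 1) / 2"
proof -
  interpret N: prob_space N using N by (simp add: space_prob_algebra)
  interpret M: prob_space M using M by (simp add: space_prob_algebra)
  have s: "sets N = sets S" "sets M = sets S" using M N by (simp_all add: space_prob_algebra)
  have A': "A \<inter> space N = A" "A \<inter> space M = A"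
    using A s sets.sets_into_space[OF A] by (auto dest: sets_eq_imp_space_eq)
  let ?q = "measure N A" and ?p = "measure M A"
  have "((\<integral>x. indicat_real A x \<partial>M) - (\<integral>x. indicat_real A x \<partial>N))\<^sup>2
      \<le> (K - 1) * ((\<integral>x. (indicat_real A x)\<^sup>2 \<partial>N) - (\<integral>x. indicat_real A x \<partial>N)\<^sup>2)"
    by (rule chi2_bounded_centred[OF M N K, where B=1]) (use A K1 in \<open>auto simp: indicator_def\<close>)
  also have "(\<lambda>x. (indicat_real A x)\<^sup>2) = indicat_real A" by (auto simp: indicator_def)
  finally have "(?p - ?q)\<^sup>2 \<le> (K - 1) * (?q - ?q\<^sup>2)" using A' by simp
  moreover have "(K - 1) * (?q - ?q\<^sup>2) \<le> (K - 1) * (1 / 4)"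
  proof (rule mult_left_mono)
    show "?q - ?q\<^sup>2 \<le> 1 / 4"
      using zero_le_power2[of "?q - 1 / 2"]
      by (simp add: power2_eq_square algebra_simps)
  qed (use K1 in simp)
  ultimately have "(?p - ?q)\<^sup>2 \<le> (K - 1) * (1 / 4)" by (rule order_trans)
  then have "(?p - ?q)\<^sup>2 \<le> (sqrt (K - 1) / 2)\<^sup>2"
    using K1 by (simp add: power_divide)
  then show ?thesis by (rule power2_le_imp_le) (use K1 in simp)
qed

lemma chi2_bounded_refl:
  assumes M: "M \<in> space (prob_algebra S)"
  shows "chi2_bounded 1 M M"
proof (rule chi2_boundedI)
  interpret M: prob_space M using M by (simp add: space_prob_algebra)
  show "sets M = sets S" using M by (simp add: space_prob_algebra)
  fix f :: "_ \<Rightarrow> real" and B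
  assume f: "f \<in> borel_measurable S" and b: "\<And>x. x \<in> space S \<Longrightarrow> \<bar>f x\<bar> \<le> B"
  have "integrable M f" by (rule bounded_integrable[OF M f b])
  moreover have "integrable M (\<lambda>x. (f x)\<^sup>2)"
    by (rule bounded_integrable[OF M]) (use f b square_bound in auto)
  ultimately show "(\<integral>x. f x \<partial>M)\<^sup>2 \<le> 1 * (\<integral>x. (f x)\<^sup>2 \<partial>M)"
    using M.variance_eq[of f] M.variance_positive[of f] by simp
qed

section \<open>Outputs of a sequentially interactive channel\<close>

lemma history_extend_measurable:
  "(\<lambda>(z, w). z(i := w)) \<in> history Q i \<Otimes>\<^sub>M outsp Q i \<rightarrow>\<^sub>M history Q (Suc i)"
  using measurable_add_dim[of i "{0..<i}" "outsp Q"]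
  by (simp add: history_def atLeastLessThanSuc)

lemma extension_kernel_measurable:
  assumes "seq_interactive X n Q" "i < n"
  shows "(\<lambda>(x, z). distr (kern Q i x z) (history Q (Suc i)) (\<lambda>w. z(i := w)))
    \<in> X \<Otimes>\<^sub>M history Q i \<rightarrow>\<^sub>M prob_algebra (history Q (Suc i))"
proof -
  have k: "(\<lambda>p. kern Q i (fst p) (snd p)) \<in> X \<Otimes>\<^sub>M history Q i \<rightarrow>\<^sub>M prob_algebra (outsp Q i)"
    using assms unfolding seq_interactive_def case_prod_beta by blast
  have u: "(\<lambda>(p, w). (snd p)(i := w)) \<in> (X \<Otimes>\<^sub>M history Q i) \<Otimes>\<^sub>M outsp Q i \<rightarrow>\<^sub>M history Q (Suc i)"
  proof -
    have "(\<lambda>q. (snd (fst q), snd q))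
        \<in> (X \<Otimes>\<^sub>M history Q i) \<Otimes>\<^sub>M outsp Q i \<rightarrow>\<^sub>M history Q i \<Otimes>\<^sub>M outsp Q i"
      by measurable
    from measurable_compose[OF this history_extend_measurable] show ?thesis
      by (simp add: case_prod_beta)
  qed
  show ?thesis
    using measurable_distr_prob_space2[OF k u] by (simp add: case_prod_beta)
qed

lemma output_step_measurable:
  assumes Q: "seq_interactive X n Q" "i < n" and P: "P \<in> space (prob_algebra X)"
  shows "(\<lambda>z. P \<bind> (\<lambda>x. distr (kern Q i x z) (history Q (Suc i)) (\<lambda>w. z(i := w))))
    \<in> history Q i \<rightarrow>\<^sub>M prob_algebra (history Q (Suc i))"
proof (rule measurable_bind_prob_space2[where N = X])
  show "(\<lambda>z. P) \<in> history Q i \<rightarrow>\<^sub>M prob_algebra X" using P by simp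
  show "(\<lambda>(z, x). distr (kern Q i x z) (history Q (Suc i)) (\<lambda>w. z(i := w)))
    \<in> history Q i \<Otimes>\<^sub>M X \<rightarrow>\<^sub>M prob_algebra (history Q (Suc i))"
    using measurable_compose[OF measurable_pair_swap' extension_kernel_measurable[OF Q]]
    by (simp add: case_prod_beta)
qed

lemma output_law_prob_algebra:
  assumes Q: "seq_interactive X n Q" and P: "P \<in> space (prob_algebra X)"
  shows "i \<le> n \<Longrightarrow> output_law Q P i \<in> space (prob_algebra (history Q i))"
proof (induction i)
  case 0
  have "(\<lambda>_. undefined) \<in> space (history Q 0)"
    by (simp add: history_def space_PiM)
  then show ?case by (simp add: space_prob_algebra prob_space_return)
next
  case (Suc i)
  then show ?case
    using bind_prob_algebra[OF _ output_step_measurable[OF Q _ P]] by simp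
qed

text \<open>
  Conditionally on the past outputs, one step is a private channel applied to a fresh observation,
  so every step contributes the same factor, however the channel uses the past.
\<close>

lemma output_law_chi2_bounded:
  assumes Q: "Q \<in> renyi2_channels X n \<rho>" and \<rho>: "0 < \<rho>"
    and P0: "P0 \<in> space (prob_algebra X)" and P1: "P1 \<in> space (prob_algebra X)"
    and D: "\<And>g B. g \<in> borel_measurable X \<Longrightarrow> (\<And>x. x \<in> space X \<Longrightarrow> \<bar>g x\<bar> \<le> B) \<Longrightarrow>
       \<bar>(\<integral>x. g x \<partial>P1) - (\<integral>x. g x \<partial>P0)\<bar> \<le> D * B"
  shows "i \<le> n \<Longrightarrow> chi2_bounded ((1 + (exp \<rho> - 1) * D\<^sup>2) ^ i) (output_law Q P1 i) (output_law Q P0 i)"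
proof (induction i)
  case 0
  have "seq_interactive X n Q" using Q by (simp add: renyi2_channels_def)
  from chi2_bounded_refl[OF output_law_prob_algebra[OF this P0, of 0]] show ?case by simp
next
  case (Suc i)
  then have i: "i < n" by simp
  have Qs: "seq_interactive X n Q" and Qp: "renyi2_private X n \<rho> Q"
    using Q by (simp_all add: renyi2_channels_def)
  have "chi2_bounded ((1 + (exp \<rho> - 1) * D\<^sup>2) ^ i * (1 + (exp \<rho> - 1) * D\<^sup>2))
    (output_law Q P1 (Suc i)) (output_law Q P0 (Suc i))"
    unfolding output_law.simps
  proof (rule chi2_bounded_bind[OF output_law_prob_algebra[OF Qs P0] output_law_prob_algebra[OF Qs P1]
        output_step_measurable[OF Qs i P0] output_step_measurable[OF Qs i P1]])
    show "i \<le> n" "i \<le> n" using i by simp_all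
    show "chi2_bounded ((1 + (exp \<rho> - 1) * D\<^sup>2) ^ i) (output_law Q P1 i) (output_law Q P0 i)"
      using Suc by simp
    show "0 \<le> (1 + (exp \<rho> - 1) * D\<^sup>2) ^ i" using \<rho> by simp
    fix z assume z: "z \<in> space (history Q i)"
    let ?\<kappa> = "\<lambda>x. distr (kern Q i x z) (history Q (Suc i)) (\<lambda>w. z(i := w))"
    show "chi2_bounded (1 + (exp \<rho> - 1) * D\<^sup>2) (P1 \<bind> ?\<kappa>) (P0 \<bind> ?\<kappa>)"
    proof (rule chi2_bounded_channel[OF P0 P1 _ _ _ D])
      show "?\<kappa> \<in> X \<rightarrow>\<^sub>M prob_algebra (history Q (Suc i))"
        using measurable_compose[OF measurable_Pair2'[OF z] extension_kernel_measurable[OF Qs i]]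
        by simp
      show "1 < exp \<rho>" using \<rho> by simp
      fix x x' assume x: "x \<in> space X" and x': "x' \<in> space X"
      have k: "kern Q i y z \<in> space (prob_algebra (outsp Q i))" if "y \<in> space X" for y
      proof -
        have "(\<lambda>(x, z). kern Q i x z) \<in> X \<Otimes>\<^sub>M history Q i \<rightarrow>\<^sub>M prob_algebra (outsp Q i)"
          using Qs i by (simp add: seq_interactive_def)
        from measurable_space[OF this, of "(y, z)"] that z show ?thesis
          by (simp add: space_pair_measure)
      qed
      show "chi2_bounded (exp \<rho>) (?\<kappa> x) (?\<kappa> x')"
      proof (rule chi2_bounded_distr)
        show "sets (kern Q i x z) = sets (outsp Q i)" "sets (kern Q i x' z) = sets (outsp Q i)"
          using k[OF x] k[OF x'] by (simp_all add: space_prob_algebra)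
        show "(\<lambda>w. z(i := w)) \<in> outsp Q i \<rightarrow>\<^sub>M history Q (Suc i)"
          using measurable_compose[OF measurable_Pair1'[OF z] history_extend_measurable] by simp
        have "renyi_div2 (kern Q i x z) (kern Q i x' z) \<le> ereal \<rho>"
          using Qp i x x' z by (simp add: renyi2_private_def)
        then show "chi2_bounded (exp \<rho>) (kern Q i x z) (kern Q i x' z)"
          by (rule renyi_div2_chi2_bounded[OF k[OF x] k[OF x']])
      qed
    qed
  qed
  then show ?case by (simp add: mult.commute)
qed

section \<open>Le Cam's two-point method\<close>

text \<open>
  The point \<open>x\<close> is a convex combination of \<open>y\<close> and \<open>- y\<close>, where the loss takes equal values.
\<close>

lemma quasiconvex_symmetric_mono:
  assumes L: "quasiconvex L" and sym: "\<And>x. L (- x) = L x" and xy: "\<bar>x\<bar> \<le> \<bar>y\<bar>"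
  shows "L x \<le> L y"
proof (cases "y = 0")
  case True
  then show ?thesis using xy by simp
next
  case False
  define t where "t = (x / y + 1) / 2"
  have "\<bar>x / y\<bar> \<le> 1" using xy False by (simp add: abs_divide)
  then have "- 1 \<le> x / y" "x / y \<le> 1" by linarith+
  then have "0 \<le> t" "t \<le> 1" by (simp_all add: t_def)
  then have "L (t * y + (1 - t) * (- y)) \<le> max (L y) (L (- y))"
    using L unfolding quasiconvex_def by blast
  moreover have "t * y + (1 - t) * (- y) = x" using False by (simp add: t_def field_simps)
  ultimately show ?thesis by (simp add: sym)
qed

text \<open>
  If an estimate is within \<open>\<delta>\<close> of the first target, it is at distance at least \<open>\<delta>\<close> from the
  second one. So on some event \<open>A\<close> the first loss is at least \<open>l\<close>, and off \<open>A\<close> the second one is.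
  As the probabilities of \<open>A\<close> differ by at most \<open>t\<close>, the two error probabilities add up to at
  least \<open>1 - t\<close>.
\<close>

lemma le_cam_two_point:
  fixes \<delta> \<psi>0 \<psi>1 t l :: real
  assumes M0: "M0 \<in> space (prob_algebra S)" and M1: "M1 \<in> space (prob_algebra S)"
    and tv: "\<And>A. A \<in> sets S \<Longrightarrow> measure M1 A - measure M0 A \<le> t"
    and est: "est \<in> borel_measurable S"
    and sep: "2 * \<delta> \<le> \<bar>\<psi>1 - \<psi>0\<bar>"
    and l: "\<And>x. \<delta> \<le> \<bar>x\<bar> \<Longrightarrow> l \<le> L x" and l0: "0 \<le> l"
  shows "ennreal ((1 - t) / 2 * l)
    \<le> max (\<integral>\<^sup>+z. ennreal (L (est z - \<psi>0)) \<partial>M0) (\<integral>\<^sup>+z. ennreal (L (est z - \<psi>1)) \<partial>M1)"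
proof -
  interpret M0: prob_space M0 using M0 by (simp add: space_prob_algebra)
  interpret M1: prob_space M1 using M1 by (simp add: space_prob_algebra)
  have s: "sets M0 = sets S" "sets M1 = sets S" using M0 M1 by (simp_all add: space_prob_algebra)
  note sp = s[THEN sets_eq_imp_space_eq]
  define A where "A = {z \<in> space S. \<delta> \<le> \<bar>est z - \<psi>0\<bar>}"
  have A: "A \<in> sets S" unfolding A_def using est by measurable
  have markov: "ennreal (l * measure M C) \<le> (\<integral>\<^sup>+z. ennreal (L (est z - c)) \<partial>M)"
    if M: "prob_space M" "sets M = sets S" and C: "C \<in> sets S"
      and far: "\<And>z. z \<in> C \<Longrightarrow> \<delta> \<le> \<bar>est z - c\<bar>" for M C c
  proof -
    interpret prob_space M by fact
    have "ennreal (l * measure M C) = (\<integral>\<^sup>+z. ennreal l * indicator C z \<partial>M)"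
      using M C l0 by (simp add: nn_integral_cmult_indicator emeasure_eq_measure ennreal_mult)
    also have "\<dots> \<le> (\<integral>\<^sup>+z. ennreal (L (est z - c)) \<partial>M)"
      by (intro nn_integral_mono) (auto simp: indicator_def intro!: ennreal_leI l far)
    finally show ?thesis .
  qed
  have 0: "ennreal (l * measure M0 A) \<le> (\<integral>\<^sup>+z. ennreal (L (est z - \<psi>0)) \<partial>M0)"
    by (rule markov) (use A s in \<open>auto simp: A_def M0.prob_space_axioms\<close>)
  have 1: "ennreal (l * measure M1 (space S - A)) \<le> (\<integral>\<^sup>+z. ennreal (L (est z - \<psi>1)) \<partial>M1)"
    by (rule markov) (use A s sep in \<open>auto simp: A_def M1.prob_space_axioms\<close>)
  have "measure M1 (space S - A) = 1 - measure M1 A"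
    using M1.prob_compl[of A] A s sp by simp
  then have "(1 - t) / 2 \<le> measure M0 A \<or> (1 - t) / 2 \<le> measure M1 (space S - A)"
    using tv[OF A] by (auto simp: field_simps)
  moreover have "ennreal ((1 - t) / 2 * l) \<le> ennreal (l * c)" if "(1 - t) / 2 \<le> c" for c
    using mult_left_mono[OF that l0] by (intro ennreal_leI) (simp add: mult_ac)
  ultimately have "ennreal ((1 - t) / 2 * l)
      \<le> max (ennreal (l * measure M0 A)) (ennreal (l * measure M1 (space S - A)))"
    unfolding le_max_iff_disj by blast
  also have "\<dots> \<le> max (\<integral>\<^sup>+z. ennreal (L (est z - \<psi>0)) \<partial>M0) (\<integral>\<^sup>+z. ennreal (L (est z - \<psi>1)) \<partial>M1)"
    by (rule max.mono[OF 0 1])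
  finally show ?thesis .
qed

section \<open>L1-differentiable families\<close>

lemma dominated_family_prob_algebra:
  "dominated_family \<mu> \<Theta> P \<Longrightarrow> \<theta> \<in> \<Theta> \<Longrightarrow> P \<theta> \<in> space (prob_algebra \<mu>)"
  by (simp add: dominated_family_def space_prob_algebra)

lemma pdens_nonneg: "0 \<le> pdens \<mu> P \<theta> x"
  by (simp add: pdens_def)

lemma
  fixes f :: "'x \<Rightarrow> real"
  assumes P: "dominated_family \<mu> \<Theta> P" "\<theta> \<in> \<Theta>" and f: "f \<in> borel_measurable \<mu>"
  shows integrable_pdens: "integrable (P \<theta>) f \<longleftrightarrow> integrable \<mu> (\<lambda>x. pdens \<mu> P \<theta> x * f x)"
    and integral_pdens: "(\<integral>x. f x \<partial>P \<theta>) = (\<integral>x. pdens \<mu> P \<theta> x * f x \<partial>\<mu>)"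
proof -
  interpret sigma_finite_measure \<mu> using P by (simp add: dominated_family_def)
  interpret P: prob_space "P \<theta>" using P by (simp add: dominated_family_def)
  have *: "sigma_finite_measure (P \<theta>)" "absolutely_continuous \<mu> (P \<theta>)" "sets (P \<theta>) = sets \<mu>"
    using P P.sigma_finite_measure_axioms by (auto simp: dominated_family_def)
  show "integrable (P \<theta>) f \<longleftrightarrow> integrable \<mu> (\<lambda>x. pdens \<mu> P \<theta> x * f x)"
    and "(\<integral>x. f x \<partial>P \<theta>) = (\<integral>x. pdens \<mu> P \<theta> x * f x \<partial>\<mu>)"
    unfolding pdens_def using RN_deriv_integrable[OF * f] RN_deriv_integral[OF * f] by simp_all
qed

lemma integrable_pdens_self:
  assumes P: "dominated_family \<mu> \<Theta> P" "\<theta> \<in> \<Theta>"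
  shows "integrable \<mu> (pdens \<mu> P \<theta>)"
proof -
  interpret P: prob_space "P \<theta>" using P by (simp add: dominated_family_def)
  show ?thesis using integrable_pdens[OF P, of "\<lambda>_. 1"] by simp
qed

lemma integral_diff_le_L1_distance:
  assumes P: "dominated_family \<mu> \<Theta> P" and t: "\<theta>0 \<in> \<Theta>" "\<theta>1 \<in> \<Theta>"
    and g[measurable]: "g \<in> borel_measurable \<mu>" and b: "\<And>x. x \<in> space \<mu> \<Longrightarrow> \<bar>g x\<bar> \<le> B"
  shows "\<bar>(\<integral>x. g x \<partial>P \<theta>1) - (\<integral>x. g x \<partial>P \<theta>0)\<bar>
    \<le> (\<integral>x. \<bar>pdens \<mu> P \<theta>1 x - pdens \<mu> P \<theta>0 x\<bar> \<partial>\<mu>) * B"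
proof -
  have i: "integrable \<mu> (\<lambda>x. pdens \<mu> P \<theta> x * g x)" if "\<theta> \<in> \<Theta>" for \<theta>
    using integrable_pdens[OF P that g] bounded_integrable[OF dominated_family_prob_algebra[OF P that] g b] by simp
  have "(\<integral>x. g x \<partial>P \<theta>1) - (\<integral>x. g x \<partial>P \<theta>0) = (\<integral>x. (pdens \<mu> P \<theta>1 x - pdens \<mu> P \<theta>0 x) * g x \<partial>\<mu>)"
    using i t by (simp add: integral_pdens[OF P _ g] left_diff_distrib)
  also have "\<bar>\<dots>\<bar> \<le> (\<integral>x. \<bar>(pdens \<mu> P \<theta>1 x - pdens \<mu> P \<theta>0 x) * g x\<bar> \<partial>\<mu>)"
    by (rule integral_abs_bound)
  also have "\<dots> \<le> (\<integral>x. \<bar>pdens \<mu> P \<theta>1 x - pdens \<mu> P \<theta>0 x\<bar> * B \<partial>\<mu>)"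
  proof (rule integral_mono)
    show "integrable \<mu> (\<lambda>x. \<bar>(pdens \<mu> P \<theta>1 x - pdens \<mu> P \<theta>0 x) * g x\<bar>)"
      using i t by (intro integrable_abs) (simp add: left_diff_distrib)
    show "integrable \<mu> (\<lambda>x. \<bar>pdens \<mu> P \<theta>1 x - pdens \<mu> P \<theta>0 x\<bar> * B)"
      using integrable_pdens_self[OF P] t by auto
    show "\<bar>(pdens \<mu> P \<theta>1 x - pdens \<mu> P \<theta>0 x) * g x\<bar> \<le> \<bar>pdens \<mu> P \<theta>1 x - pdens \<mu> P \<theta>0 x\<bar> * B"
      if "x \<in> space \<mu>" for x
      using b[OF that] by (simp add: abs_mult mult_left_mono)
  qed
  finally show ?thesis by simp
qed

text \<open>
  The remainder in the definition of differentiability is \<open>o(|h|)\<close> in \<open>L\<^sup>1\<close>, and the linear term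
  has \<open>L\<^sup>1\<close> norm exactly \<open>J |h|\<close>. The slack \<open>s > 1\<close> absorbs the remainder.
\<close>

lemma L1_distance_le_information:
  assumes P: "dominated_family \<mu> \<Theta> P" and L1: "L1_differentiable \<mu> \<Theta> P \<theta>0 score"
    and J: "0 < L1_information P \<theta>0 score" and s: "1 < s"
  shows "\<forall>\<^sub>F h in at 0. \<theta>0 + h \<in> \<Theta> \<and>
    (\<integral>x. \<bar>pdens \<mu> P (\<theta>0 + h) x - pdens \<mu> P \<theta>0 x\<bar> \<partial>\<mu>) \<le> s * L1_information P \<theta>0 score * \<bar>h\<bar>"
proof -
  let ?J = "L1_information P \<theta>0 score"
  define p where "p h = pdens \<mu> P (\<theta>0 + h)" for h
  define rem where "rem h x = p h x - p 0 x - h * score x * p 0 x" for h x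
  have int: "\<theta>0 \<in> interior \<Theta>" and [measurable]: "score \<in> borel_measurable \<mu>"
    and rem: "\<forall>\<^sub>F h in at 0. integrable \<mu> (rem h)"
    and o: "(\<lambda>h. \<integral>x. \<bar>rem h x\<bar> \<partial>\<mu>) \<in> o[at 0](\<lambda>h. h)"
    using L1 unfolding L1_differentiable_def rem_def p_def by simp_all
  have t0: "\<theta>0 \<in> \<Theta>" using int interior_subset by blast
  have p0: "integrable \<mu> (p 0)" using integrable_pdens_self[OF P t0] by (simp add: p_def)
  \<comment> \<open>A non-integrable score would have L1-information 0, the default value of the integral.\<close>
  have "integrable (P \<theta>0) (\<lambda>x. \<bar>score x\<bar>)"
    using J unfolding L1_information_def by (metis less_irrefl not_integrable_integral_eq)
  then have iJ: "integrable \<mu> (\<lambda>x. p 0 x * \<bar>score x\<bar>)"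
    using integrable_pdens[OF P t0, of "\<lambda>x. \<bar>score x\<bar>"] by (simp add: p_def)
  have J_eq: "?J = (\<integral>x. p 0 x * \<bar>score x\<bar> \<partial>\<mu>)"
    using integral_pdens[OF P t0, of "\<lambda>x. \<bar>score x\<bar>"] by (simp add: p_def L1_information_def)
  have dom: "\<forall>\<^sub>F h in at 0. \<theta>0 + h \<in> \<Theta>"
  proof -
    have "((\<lambda>h. \<theta>0 + h) \<longlongrightarrow> \<theta>0 + 0) (at 0)" by (intro tendsto_intros)
    then have "\<forall>\<^sub>F h in at 0. \<theta>0 + h \<in> interior \<Theta>"
      using int by (intro topological_tendstoD) auto
    then show ?thesis by eventually_elim (use interior_subset in blast)
  qed
  have "0 < (s - 1) * ?J" using s J by simp
  from landau_o.smallD[OF o this] rem dom show ?thesis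
  proof eventually_elim
    case (elim h)
    have small: "(\<integral>x. \<bar>rem h x\<bar> \<partial>\<mu>) \<le> (s - 1) * ?J * \<bar>h\<bar>" using elim(1) by simp
    have ph: "integrable \<mu> (p h)" using integrable_pdens_self[OF P elim(3)] by (simp add: p_def)
    have "(\<integral>x. \<bar>p h x - p 0 x\<bar> \<partial>\<mu>) \<le> (\<integral>x. \<bar>rem h x\<bar> + \<bar>h\<bar> * (p 0 x * \<bar>score x\<bar>) \<partial>\<mu>)"
    proof (rule integral_mono)
      show "integrable \<mu> (\<lambda>x. \<bar>p h x - p 0 x\<bar>)" using ph p0 by auto
      show "integrable \<mu> (\<lambda>x. \<bar>rem h x\<bar> + \<bar>h\<bar> * (p 0 x * \<bar>score x\<bar>))"
        using elim(2) iJ by auto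
      fix x
      have "\<bar>h * score x * p 0 x\<bar> = \<bar>h\<bar> * (p 0 x * \<bar>score x\<bar>)"
        using pdens_nonneg[of \<mu> P \<theta>0 x] by (simp add: abs_mult p_def mult_ac)
      then show "\<bar>p h x - p 0 x\<bar> \<le> \<bar>rem h x\<bar> + \<bar>h\<bar> * (p 0 x * \<bar>score x\<bar>)"
        unfolding rem_def by linarith
    qed
    also have "\<dots> = (\<integral>x. \<bar>rem h x\<bar> \<partial>\<mu>) + \<bar>h\<bar> * ?J"
      using elim(2) iJ by (simp add: J_eq)
    also have "\<dots> \<le> s * ?J * \<bar>h\<bar>" using small by (simp add: algebra_simps)
    finally show ?case using elim(3) by (simp add: p_def)
  qed
qed

lemma increment_ge_derivative:
  fixes \<psi> :: "real \<Rightarrow> real"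
  assumes d: "(\<psi> has_real_derivative d) (at \<theta>0)" and r: "r < 1"
  shows "\<forall>\<^sub>F h in at 0. r * \<bar>d\<bar> * \<bar>h\<bar> \<le> \<bar>\<psi> (\<theta>0 + h) - \<psi> \<theta>0\<bar>"
proof (cases "d = 0")
  case True
  then show ?thesis by simp
next
  case False
  have "((\<lambda>h. (\<psi> (\<theta>0 + h) - \<psi> \<theta>0) / h) \<longlongrightarrow> d) (at 0)" using d by (simp add: DERIV_def)
  then have "((\<lambda>h. \<bar>(\<psi> (\<theta>0 + h) - \<psi> \<theta>0) / h\<bar>) \<longlongrightarrow> \<bar>d\<bar>) (at 0)" by (rule tendsto_rabs)
  moreover have "r * \<bar>d\<bar> < \<bar>d\<bar>" using r False by simp
  ultimately have "\<forall>\<^sub>F h in at 0. r * \<bar>d\<bar> < \<bar>(\<psi> (\<theta>0 + h) - \<psi> \<theta>0) / h\<bar>"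
    by (rule order_tendstoD)
  moreover have "\<forall>\<^sub>F h in at (0::real). h \<noteq> 0" by (rule eventually_neq_at_within)
  ultimately show ?thesis by eventually_elim (simp add: abs_divide field_simps)
qed

section \<open>The choice of the second point\<close>

text \<open>
  By convexity the exponential lies below its secant on \<open>[0, 4]\<close>, whose slope is
  \<open>(exp 4 - 1) / 4\<close>, about 13.4.
\<close>

lemma exp_minus_one_le_secant:
  fixes x :: real
  assumes "0 \<le> x" "x \<le> 4"
  shows "exp x - 1 \<le> 27 / 2 * x"
proof -
  have "exp ((1 - x / 4) *\<^sub>R 0 + (x / 4) *\<^sub>R 4) \<le> (1 - x / 4) * exp 0 + (x / 4) * exp (4::real)"
    by (rule convex_onD[OF exp_convex]) (use assms in auto)
  then have "exp x - 1 \<le> x / 4 * (exp 4 - 1)" by (simp add: algebra_simps)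
  also have "exp 4 - 1 \<le> (54 :: real)"
  proof -
    have "exp (4::real) = exp 1 ^ 4" by (simp add: exp_of_nat_mult[symmetric])
    also have "\<dots> \<le> (272 / 100) ^ 4" using e_less_272 by (intro power_mono) auto
    also have "\<dots> \<le> 55" by (simp add: power_divide)
    finally show ?thesis by simp
  qed
  finally show ?thesis using assms by (simp add: mult_left_mono)
qed

lemma exp_116_le: "exp (116 / 100) \<le> (13 / 4 :: real)"
proof -
  have "1 - 16 / 100 \<le> exp (- (16 / 100) :: real)" using exp_ge_add_one_self[of "- (16 / 100)"] by simp
  then have "exp (16 / 100 :: real) \<le> 100 / 84" by (simp add: exp_minus field_simps)
  moreover have "exp (116 / 100 :: real) = exp 1 * exp (16 / 100)" by (simp add: exp_add[symmetric])
  ultimately show ?thesis using e_less_272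
    using mult_mono[of "exp 1" "272 / 100" "exp (16 / 100)" "100 / 84 :: real"] by simp
qed


text \<open>
  Here \<open>\<epsilon> \<le> 2\<close> replaces \<open>exp (\<epsilon>\<^sup>2) - 1\<close> by a multiple of \<open>\<epsilon>\<^sup>2\<close>, and then
  \<open>D\<^sup>2\<close>, of order \<open>1 / (n \<epsilon>\<^sup>2)\<close>, cancels both the privacy level and the number of steps:
  the exponent \<open>n (exp (\<epsilon>\<^sup>2) - 1) D\<^sup>2\<close> is at most \<open>(27/2) (0.2929)\<^sup>2 < 1.16\<close>.
  The bound 13/4 corresponds to a difference of probabilities of at most
  \<open>sqrt (13/4 - 1) / 2 = 3/4\<close>, and so to the factor 1/8 in Le Cam's method.
\<close>

lemma privacy_budget_bound:
  fixes n :: nat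
  assumes n: "0 < n" and \<epsilon>: "0 < \<epsilon>" "\<epsilon> \<le> 2" and J: "0 < J"
    and D: "0 \<le> D" "D \<le> 101 / 100 * J * (29 / (100 * (\<epsilon> * J)) / sqrt n)"
  shows "(1 + (exp (\<epsilon>\<^sup>2) - 1) * D\<^sup>2) ^ n \<le> 13 / 4"
proof -
  let ?E = "(exp (\<epsilon>\<^sup>2) - 1) * D\<^sup>2"
  have E: "exp (\<epsilon>\<^sup>2) - 1 \<le> 27 / 2 * \<epsilon>\<^sup>2"
    using exp_minus_one_le_secant[of "\<epsilon>\<^sup>2"] power_mono[of \<epsilon> 2 2] \<epsilon> by simp
  have "D\<^sup>2 \<le> (2929 / 10000 / (\<epsilon> * sqrt n))\<^sup>2"
    using D J by (intro power_mono) (simp_all add: field_simps)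
  also have "\<dots> = (2929 / 10000)\<^sup>2 / (\<epsilon>\<^sup>2 * n)"
    by (simp add: power_divide power_mult_distrib)
  finally have "?E \<le> 27 / 2 * \<epsilon>\<^sup>2 * ((2929 / 10000)\<^sup>2 / (\<epsilon>\<^sup>2 * n))"
    by (intro mult_mono E) auto
  also have "\<dots> = 27 / 2 * (2929 / 10000)\<^sup>2 / n" using \<epsilon> by simp
  finally have "n * ?E \<le> 27 / 2 * (2929 / 10000)\<^sup>2" using n by (simp add: field_simps)
  then have nE: "n * ?E \<le> 116 / 100" by (simp add: power2_eq_square)
  have "(1 + ?E) ^ n \<le> exp ?E ^ n"
    by (intro power_mono exp_ge_add_one_self) (simp_all add: add_nonneg_nonneg)
  also have "\<dots> = exp (n * ?E)" by (simp add: exp_of_nat_mult)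
  also have "\<dots> \<le> exp (116 / 100)" using nE by simp
  also have "\<dots> \<le> 13 / 4" by (rule exp_116_le)
  finally show ?thesis .
qed

text \<open>
  The step \<open>0.29 / (\<epsilon> J sqrt n)\<close> is a little more than \<open>2 / (5 sqrt 2) = 0.2828...\<close> times
  \<open>1 / (\<epsilon> J sqrt n)\<close>; the excess pays for the factor 0.98 lost in the linearization of
  \<open>\<psi>\<close>.
\<close>

lemma separation_bound:
  fixes n :: nat and a :: real
  assumes n: "0 < n" and \<epsilon>: "0 < \<epsilon>" and J: "0 < J"
    and sep: "98 / 100 * \<bar>a\<bar> * \<bar>29 / (100 * (\<epsilon> * J)) / sqrt n\<bar> \<le> s"
  shows "2 * \<bar>1 / (5 * sqrt (2 * real n * \<epsilon>\<^sup>2)) * (inverse J * a)\<bar> \<le> s"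
proof -
  define X where "X = \<bar>a\<bar> / (\<epsilon> * J * sqrt n)"
  have X: "0 \<le> X" using \<epsilon> J by (simp add: X_def)
  have "2 / (5 * sqrt 2) \<le> (2842 / 10000 :: real)"
  proof -
    have "1408 / 1000 \<le> sqrt (2 :: real)" by (rule real_le_rsqrt) (simp add: power2_eq_square)
    then show ?thesis by (simp add: field_simps)
  qed
  from mult_right_mono[OF this X]
  have "2 / (5 * sqrt 2) * X \<le> 2842 / 10000 * X" .
  moreover have "2 * \<bar>1 / (5 * sqrt (2 * real n * \<epsilon>\<^sup>2)) * (inverse J * a)\<bar> = 2 / (5 * sqrt 2) * X"
    using \<epsilon> J by (simp add: X_def real_sqrt_mult abs_mult field_simps)
  moreover have "98 / 100 * \<bar>a\<bar> * \<bar>29 / (100 * (\<epsilon> * J)) / sqrt n\<bar> = 2842 / 10000 * X"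
    using \<epsilon> J by (simp add: X_def abs_mult field_simps)
  ultimately show ?thesis using sep by linarith
qed

lemma two_point_minimax_bound:
  fixes Q :: "('x, 'z) channel"
  assumes P: "dominated_family \<mu> \<Theta> P" and t: "\<theta>0 \<in> \<Theta>" "\<theta>1 \<in> \<Theta>"
    and L: "quasiconvex L" "\<And>x. L (- x) = L x" "\<And>x. 0 \<le> L x"
    and Q: "Q \<in> renyi2_channels \<mu> n \<rho>" and \<rho>: "0 < \<rho>"
    and est: "est \<in> history Q n \<rightarrow>\<^sub>M borel"
    and budget: "(1 + (exp \<rho> - 1) * (\<integral>x. \<bar>pdens \<mu> P \<theta>1 x - pdens \<mu> P \<theta>0 x\<bar> \<partial>\<mu>)\<^sup>2) ^ n \<le> 13 / 4"
    and sep: "2 * \<bar>\<delta>\<bar> \<le> \<bar>\<psi> \<theta>1 - \<psi> \<theta>0\<bar>"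
  shows "ennreal (1 / 8 * L \<delta>) \<le> max (risk n L P \<psi> Q est \<theta>0) (risk n L P \<psi> Q est \<theta>1)"
proof -
  note P0 = dominated_family_prob_algebra[OF P t(1)] and P1 = dominated_family_prob_algebra[OF P t(2)]
  have Qs: "seq_interactive \<mu> n Q" using Q by (simp add: renyi2_channels_def)
  note M0 = output_law_prob_algebra[OF Qs P0 order_refl] and M1 = output_law_prob_algebra[OF Qs P1 order_refl]
  have "chi2_bounded ((1 + (exp \<rho> - 1) * (\<integral>x. \<bar>pdens \<mu> P \<theta>1 x - pdens \<mu> P \<theta>0 x\<bar> \<partial>\<mu>)\<^sup>2) ^ n)
      (output_law Q (P \<theta>1) n) (output_law Q (P \<theta>0) n)"
    by (rule output_law_chi2_bounded[OF Q \<rho> P0 P1 integral_diff_le_L1_distance[OF P t] order_refl])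
  from chi2_bounded_mono[OF this budget]
  have bounded: "chi2_bounded (13 / 4) (output_law Q (P \<theta>1) n) (output_law Q (P \<theta>0) n)" .
  have tv: "measure (output_law Q (P \<theta>1) n) A - measure (output_law Q (P \<theta>0) n) A \<le> 3 / 4"
    if "A \<in> sets (history Q n)" for A
  proof -
    have "sqrt (13 / 4 - 1) / 2 = (3 / 4 :: real)"
      using real_sqrt_unique[of "3 / 2" "13 / 4 - 1"] by (simp add: power2_eq_square)
    then show ?thesis using chi2_bounded_prob_diff[OF M1 M0 bounded _ that] by simp
  qed
  have "ennreal ((1 - 3 / 4) / 2 * L \<delta>)
      \<le> max (risk n L P \<psi> Q est \<theta>0) (risk n L P \<psi> Q est \<theta>1)"
    unfolding risk_def
  proof (rule le_cam_two_point[OF M0 M1 tv est sep])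
    show "L \<delta> \<le> L x" if "\<bar>\<delta>\<bar> \<le> \<bar>x\<bar>" for x
      by (rule quasiconvex_symmetric_mono[OF L(1,2) that])
  qed (use L in auto)
  then show ?thesis by simp
qed

(* The upper bound on \<epsilon> is needed: privacy bounds the chi-square divergence between kernels by
   exp(\<epsilon>^2) - 1, and for large \<epsilon> the inequality with \<epsilon>^2 is false.  For squared loss,
   \<psi> \<theta> = \<theta> and P \<theta> = Bernoulli(\<theta>) with \<theta>0 = exp(-\<epsilon>^2) (so the L1-information is 2),
   flipping each observation with probability exp(-\<epsilon>^2) gives a private channel whose risk is of
   order exp(-\<epsilon>^2) / n, which for \<epsilon> = 4 is below the claimed 1 / (1600 n \<epsilon>^2). *)
theorem proposition4:
  fixes \<Theta> :: "real set" and \<mu> :: "'x measure" and P :: "real \<Rightarrow> 'x measure"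
    and score :: "'x \<Rightarrow> real" and \<psi> :: "real \<Rightarrow> real" and \<theta>0 \<epsilon> :: real
  assumes "dominated_family \<mu> \<Theta> P"
    and "L1_differentiable \<mu> \<Theta> P \<theta>0 score"
    and "L1_information P \<theta>0 score > 0"
    and "\<exists>S. open S \<and> \<theta>0 \<in> S \<and> S \<subseteq> \<Theta> \<and> \<psi> C1_differentiable_on S"
    and "0 < \<epsilon>" and "\<epsilon> \<le> 2"
  shows "\<exists>N::nat. \<forall>L::real \<Rightarrow> real.
    (\<forall>x. 0 \<le> L x) \<and> (\<forall>x. L (- x) = L x) \<and> quasiconvex L \<and> L 0 = 0 \<longrightarrow>
    (\<forall>n\<ge>N. local_minimax_risk n \<theta>0 L \<Theta> P \<psi> (renyi2_channels \<mu> n (\<epsilon>\<^sup>2) :: ('x, 'z) channel set)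
      \<ge> ennreal (1 / 8 * L (1 / (5 * sqrt (2 * real n * \<epsilon>\<^sup>2))
            * (inverse (L1_information P \<theta>0 score) * deriv \<psi> \<theta>0))))"
proof -
  let ?J = "L1_information P \<theta>0 score" and ?d = "deriv \<psi> \<theta>0"
  let ?D = "\<lambda>\<theta>1. \<integral>x. \<bar>pdens \<mu> P \<theta>1 x - pdens \<mu> P \<theta>0 x\<bar> \<partial>\<mu>"
  define h where "h n = 29 / (100 * (\<epsilon> * ?J)) / sqrt (real n)" for n :: nat
  have t0: "\<theta>0 \<in> \<Theta>" using assms(4) by blast
  obtain D where "(\<psi> has_vector_derivative D) (at \<theta>0)"
    using assms(4) unfolding C1_differentiable_on_def by blast
  then have "(\<psi> has_real_derivative D) (at \<theta>0)"
    by (simp add: has_real_derivative_iff_has_vector_derivative)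
  then have "(\<psi> has_real_derivative ?d) (at \<theta>0)"
    by (simp add: DERIV_imp_deriv)
  then have "\<forall>\<^sub>F h in at 0. 98 / 100 * \<bar>?d\<bar> * \<bar>h\<bar> \<le> \<bar>\<psi> (\<theta>0 + h) - \<psi> \<theta>0\<bar>"
    by (rule increment_ge_derivative) simp
  moreover have "\<forall>\<^sub>F h in at 0. \<theta>0 + h \<in> \<Theta> \<and> ?D (\<theta>0 + h) \<le> 101 / 100 * ?J * \<bar>h\<bar>"
    by (rule L1_distance_le_information[OF assms(1-3)]) simp
  ultimately have ev: "\<forall>\<^sub>F h in at 0. 98 / 100 * \<bar>?d\<bar> * \<bar>h\<bar> \<le> \<bar>\<psi> (\<theta>0 + h) - \<psi> \<theta>0\<bar> \<and>
      \<theta>0 + h \<in> \<Theta> \<and> ?D (\<theta>0 + h) \<le> 101 / 100 * ?J * \<bar>h\<bar>"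
    by eventually_elim auto
  have "filterlim h (at 0) sequentially"
  proof (rule filterlim_atI)
    show "h \<longlonglongrightarrow> 0" unfolding h_def
      by (rule real_tendsto_divide_at_top[OF tendsto_const
          filterlim_compose[OF sqrt_at_top filterlim_real_sequentially]])
    show "\<forall>\<^sub>F n in sequentially. h n \<noteq> 0"
      using eventually_gt_at_top[of 0] by eventually_elim (use assms(3,5) in \<open>simp add: h_def\<close>)
  qed
  from eventually_conj[OF eventually_gt_at_top[of 0] eventually_compose_filterlim[OF ev this]]
  obtain N where N: "\<And>n. n \<ge> N \<Longrightarrow> 0 < n"
      "\<And>n. n \<ge> N \<Longrightarrow> 98 / 100 * \<bar>?d\<bar> * \<bar>h n\<bar> \<le> \<bar>\<psi> (\<theta>0 + h n) - \<psi> \<theta>0\<bar>"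
      "\<And>n. n \<ge> N \<Longrightarrow> \<theta>0 + h n \<in> \<Theta>"
      "\<And>n. n \<ge> N \<Longrightarrow> ?D (\<theta>0 + h n) \<le> 101 / 100 * ?J * \<bar>h n\<bar>"
    unfolding eventually_sequentially by auto
  show ?thesis
  proof (intro exI allI impI)
    fix L :: "real \<Rightarrow> real" and n
    assume L: "(\<forall>x. 0 \<le> L x) \<and> (\<forall>x. L (- x) = L x) \<and> quasiconvex L \<and> L 0 = 0" and n: "N \<le> n"
    let ?\<delta> = "1 / (5 * sqrt (2 * real n * \<epsilon>\<^sup>2)) * (inverse ?J * ?d)"
    have h0: "0 \<le> h n" using assms(3,5) by (simp add: h_def)
    have budget: "(1 + (exp (\<epsilon>\<^sup>2) - 1) * (?D (\<theta>0 + h n))\<^sup>2) ^ n \<le> 13 / 4"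
      by (rule privacy_budget_bound[OF N(1)[OF n] assms(5,6,3)])
        (use N(4)[OF n] h0 in \<open>simp_all add: h_def\<close>)
    have sep: "2 * \<bar>?\<delta>\<bar> \<le> \<bar>\<psi> (\<theta>0 + h n) - \<psi> \<theta>0\<bar>"
      by (rule separation_bound[OF N(1)[OF n] assms(5,3)]) (use N(2)[OF n] in \<open>simp only: h_def\<close>)
    show "ennreal (1 / 8 * L ?\<delta>)
      \<le> local_minimax_risk n \<theta>0 L \<Theta> P \<psi> (renyi2_channels \<mu> n (\<epsilon>\<^sup>2) :: ('x, 'z) channel set)"
      unfolding local_minimax_risk_def
    proof (rule SUP_upper2[OF N(3)[OF n]], intro INF_greatest)
      fix Q :: "('x, 'z) channel" and est :: "(nat \<Rightarrow> 'z) \<Rightarrow> real"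
      assume "Q \<in> renyi2_channels \<mu> n (\<epsilon>\<^sup>2)" "est \<in> history Q n \<rightarrow>\<^sub>M borel"
      then show "ennreal (1 / 8 * L ?\<delta>)
          \<le> max (risk n L P \<psi> Q est \<theta>0) (risk n L P \<psi> Q est (\<theta>0 + h n))"
        using L assms(5)
        by (intro two_point_minimax_bound[OF assms(1) t0 N(3)[OF n] _ _ _ _ _ _ budget sep]) auto
    qed
  qed
qed

end
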